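(* Let $q$ be a prime power, let $k,m$ be positive integers, let $\mathbb{V}(k,q^m)$ be a $k$-dimensional $\mathbb{F}_{q^m}$-vector space and let $U$ be an $\mathbb{F}_q$-subspace of $\mathbb{V}(k,q^m)$ with $\dim_{\mathbb{F}_q}(U)=n$ and $\langle U\rangle_{\mathbb{F}_{q^m}}=\mathbb{V}(k,q^m)$. Let $t_s=\min\{\dim_{\mathbb{F}_{q^m}}(T): T \text{ an } \mathbb{F}_{q^m}\text{-subspace of } \mathbb{V}(k,q^m) \text{ with } \varepsilon_U(T)=n-k\}$. Then $t_s<k$ if and only if there exists an $\mathbb{F}_{q^m}$-hyperplane $H$ of $\mathbb{V}(k,q^m)$ such that $w_U(H)=n-1$.
   Context: $\mathbb{V}(k,q^m)$ is regarded also as an $\mathbb{F}_q$-vector space. For an $\mathbb{F}_q$-subspace $U$ and an $\mathbb{F}_{q^m}$-subspace $T$ of $\mathbb{V}(k,q^m)$, the weight of $T$ with respect to $U$ is $w_U(T)=\dim_{\mathbb{F}_q}(U\cap T)$ and the defect of $T$ with respect to $U$ is $\varepsilon_U(T)=w_U(T)-\dim_{\mathbb{F}_{q^m}}(T)$. (Note $\varepsilon_U(\mathbb{V}(k,q^m))=n-k$ and $n-k$ is the largest possible defect.) *)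

theory Defs
  imports "HOL-Number_Theory.Prime_Powers" "HOL-Library.Cardinality"
begin

text \<open>
  The extension \<open>F\<^sub>q \<subseteq> F\<^sub>q\<^sup>m\<close> is modelled by two field types \<open>'f\<close> and \<open>'e\<close> together with an embedding
  \<open>\<phi>\<close>; a homomorphism of fields that maps 1 to 1 is automatically injective.
\<close>

locale field_embedding =
  fixes \<phi> :: "'f::field \<Rightarrow> 'e::field"
  assumes embed_add: "\<phi> (a + b) = \<phi> a + \<phi> b"
    and embed_mult: "\<phi> (a * b) = \<phi> a * \<phi> b"
    and embed_one: "\<phi> 1 = 1"

definition restrict_scalars :: "('f \<Rightarrow> 'e) \<Rightarrow> ('e \<Rightarrow> 'v \<Rightarrow> 'v) \<Rightarrow> 'f \<Rightarrow> 'v \<Rightarrow> 'v" where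
  "restrict_scalars \<phi> scale = (\<lambda>a v. scale (\<phi> a) v)"

lemma vector_space_restrict_scalars:
  assumes "field_embedding \<phi>" and "vector_space scale"
  shows "vector_space (restrict_scalars \<phi> scale)"
proof -
  interpret field_embedding \<phi> by fact
  interpret vector_space scale by fact
  show ?thesis
    by unfold_locales
      (simp_all add: restrict_scalars_def embed_add embed_mult embed_one
        scale_right_distrib scale_left_distrib)
qed

definition weight ::
  "('f::field \<Rightarrow> 'e::field) \<Rightarrow> ('e \<Rightarrow> 'v::ab_group_add \<Rightarrow> 'v) \<Rightarrow> 'v set \<Rightarrow> 'v set \<Rightarrow> nat" where
  "weight \<phi> scale U T = vector_space.dim (restrict_scalars \<phi> scale) (U \<inter> T)"

text \<open>The defect may be negative, hence the integers.\<close>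

definition defect ::
  "('f::field \<Rightarrow> 'e::field) \<Rightarrow> ('e \<Rightarrow> 'v::ab_group_add \<Rightarrow> 'v) \<Rightarrow> 'v set \<Rightarrow> 'v set \<Rightarrow> int" where
  "defect \<phi> scale U T = int (weight \<phi> scale U T) - int (vector_space.dim scale T)"

definition is_hyperplane :: "('e::field \<Rightarrow> 'v::ab_group_add \<Rightarrow> 'v) \<Rightarrow> 'v set \<Rightarrow> bool" where
  "is_hyperplane scale H \<longleftrightarrow>
     module.subspace scale H \<and>
     vector_space.dim scale H + 1 = vector_space.dim scale (UNIV :: 'v set)"

lemma defect_UNIV:
  "defect \<phi> scale U UNIV =
     int (vector_space.dim (restrict_scalars \<phi> scale) U) - int (vector_space.dim scale UNIV)"
  by (simp add: defect_def weight_def)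

end

theory Submission
  imports Defs
begin

text \<open>
  Adjoining to a proper \<open>F\<^sub>q\<^sup>m\<close>-subspace \<open>T\<close> a vector of \<open>U\<close> outside \<open>T\<close> raises the dimension by exactly
  one and the weight by at least one, so the defect does not drop. As \<open>U\<close> spans the whole space,
  a subspace of defect \<open>n - k\<close> and dimension below \<open>k\<close> therefore grows to a hyperplane of weight at
  least \<open>n - 1\<close>; weight \<open>n\<close> is impossible because \<open>U\<close> lies in no hyperplane. Conversely, a hyperplane
  of weight \<open>n - 1\<close> itself has defect \<open>n - k\<close>.
\<close>

text \<open>Every vector of \<open>span (insert b B)\<close> has the form
  \<open>x + scale c b\<close> with \<open>x\<close> in \<open>span B\<close>, and there are only
  finitely many scalars \<open>c\<close>.\<close>

lemma finite_span_over_finite_field: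
  fixes scale :: "'e::{field,finite} \<Rightarrow> 'v::ab_group_add \<Rightarrow> 'v"
  assumes "vector_space scale" and "finite B"
  shows "finite (module.span scale B)"
proof -
  interpret vector_space scale by fact
  show ?thesis
    using \<open>finite B\<close>
  proof (induction B rule: finite_induct)
    case empty
    show ?case by simp
  next
    case (insert b B)
    have "span (insert b B) \<subseteq> (\<lambda>(c, x). x + scale c b) ` (UNIV \<times> span B)"
    proof
      fix x assume "x \<in> span (insert b B)"
      then obtain c where "x - scale c b \<in> span B"
        by (auto simp: span_insert)
      then show "x \<in> (\<lambda>(c, x). x + scale c b) ` (UNIV \<times> span B)"
        by (intro image_eqI[where x = "(c, x - scale c b)"]) auto
    qed
    then show ?case
      by (rule finite_subset) (use insert.IH in auto)
  qed
qed

lemma finite_dimensional_if_finite: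
  fixes scale :: "'e::field \<Rightarrow> 'v::ab_group_add \<Rightarrow> 'v"
  assumes "vector_space scale" and "finite (UNIV :: 'v set)"
  obtains B where "finite_dimensional_vector_space scale B"
proof -
  interpret vector_space scale by fact
  obtain B where "independent B" "UNIV \<subseteq> span B"
    using maximal_independent_subset[of UNIV] by blast
  moreover have "finite B"
    using assms(2) by (rule finite_subset[rotated]) simp
  ultimately have "finite_dimensional_vector_space scale B"
    by unfold_locales auto
  then show thesis by (rule that)
qed

text \<open>\<open>dim\<close> is the cardinality of a basis, and \<open>card\<close> is 0 on
  infinite sets. A positive dimension therefore rules out an infinite basis, and a finite one spans
  only finitely many vectors over a finite field.\<close>

lemma finite_UNIV_if_dim_pos:
  fixes scale :: "'e::{field,finite} \<Rightarrow> 'v::ab_group_add \<Rightarrow> 'v"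
  assumes "vector_space scale" and "vector_space.dim scale (UNIV :: 'v set) > 0"
  shows "finite (UNIV :: 'v set)"
proof -
  interpret vector_space scale by fact
  obtain B where B: "UNIV \<subseteq> span B" "card B = dim UNIV"
    using basis_exists[of UNIV] by blast
  then have "finite B"
    using assms(2) card_ge_0_finite by metis
  then have "finite (span B)"
    using finite_span_over_finite_field assms(1) by blast
  then show ?thesis
    using B(1) finite_subset by blast
qed

text \<open>Finiteness is required of the set of vectors because in this form it serves both scalar
  fields at once: it gives a finite basis over each of them. It also leaves only finitely many
  subspaces.\<close>

locale finite_restriction =
  field_embedding \<phi> + vector_space scale
  for \<phi> :: "'f::field \<Rightarrow> 'e::field" and scale :: "'e \<Rightarrow> 'v::ab_group_add \<Rightarrow> 'v" +
  fixes U :: "'v set"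
  assumes finite_UNIV: "finite (UNIV :: 'v set)"
    and U_subspace: "module.subspace (restrict_scalars \<phi> scale) U"
    and span_U: "span U = UNIV"
begin

lemma finite_dimensional:
  obtains B where "finite_dimensional_vector_space scale B"
  using finite_dimensional_if_finite[OF vector_space_axioms finite_UNIV] .

lemma finite_dimensional_restrict_scalars:
  obtains B where "finite_dimensional_vector_space (restrict_scalars \<phi> scale) B"
  using finite_dimensional_if_finite[OF
      vector_space_restrict_scalars[OF field_embedding_axioms vector_space_axioms] finite_UNIV] .

lemma subspace_restrict_scalars:
  assumes "subspace T"
  shows "module.subspace (restrict_scalars \<phi> scale) T"
proof -
  interpret F: vector_space "restrict_scalars \<phi> scale"
    by (rule vector_space_restrict_scalars) unfold_locales
  show ?thesis
    using assms unfolding F.subspace_def subspace_def by (simp add: restrict_scalars_def)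
qed

lemma dim_span_insert:
  assumes "subspace T" and "u \<notin> T"
  shows "dim (span (insert u T)) = dim T + 1"
proof -
  obtain B where "finite_dimensional_vector_space scale B" by (rule finite_dimensional)
  then interpret E: finite_dimensional_vector_space scale B .
  show ?thesis
    using assms by (simp add: E.dim_insert span_eq_iff[THEN iffD2])
qed

text \<open>The vector \<open>u\<close> is new in the intersection with \<open>U\<close>. Only an
  inequality holds, as multiples of \<open>u\<close> by scalars of the larger field, shifted by
  vectors of \<open>T\<close>, may lie in \<open>U\<close> too.\<close>

lemma weight_span_insert:
  assumes "subspace T" and "u \<in> U" and "u \<notin> T"
  shows "weight \<phi> scale U T + 1 \<le> weight \<phi> scale U (span (insert u T))"
proof -
  obtain B where "finite_dimensional_vector_space (restrict_scalars \<phi> scale) B"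
    by (rule finite_dimensional_restrict_scalars)
  then interpret F: finite_dimensional_vector_space "restrict_scalars \<phi> scale" B .
  \<comment> \<open>Being a subspace over the small field, \<open>U \<inter> T\<close> is its own
    span, so \<open>u\<close> is independent of it.\<close>
  have "F.subspace (U \<inter> T)"
    using U_subspace subspace_restrict_scalars[OF assms(1)] by (rule F.subspace_inter)
  then have "F.dim (insert u (U \<inter> T)) = F.dim (U \<inter> T) + 1"
    using assms(3) by (simp add: F.dim_insert F.span_eq_iff[THEN iffD2])
  moreover have "insert u (U \<inter> T) \<subseteq> U \<inter> span (insert u T)"
    using assms(2) by (auto intro: span_base)
  then have "F.dim (insert u (U \<inter> T)) \<le> F.dim (U \<inter> span (insert u T))"
    by (rule F.dim_subset)
  ultimately show ?thesis by (simp add: weight_def)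
qed

lemma not_subset_if_dim_less:
  assumes "subspace T" and "dim T < dim UNIV"
  shows "\<not> U \<subseteq> T"
proof
  assume "U \<subseteq> T"
  then have "span U \<subseteq> T" using assms(1) by (rule span_minimal)
  then have "T = UNIV" using span_U by auto
  then show False using assms(2) by simp
qed

lemma weight_less_if_dim_less:
  assumes "subspace T" and "dim T < dim UNIV"
  shows "weight \<phi> scale U T < vector_space.dim (restrict_scalars \<phi> scale) U"
proof -
  obtain B where "finite_dimensional_vector_space (restrict_scalars \<phi> scale) B"
    by (rule finite_dimensional_restrict_scalars)
  then interpret F: finite_dimensional_vector_space "restrict_scalars \<phi> scale" B .
  obtain u where "u \<in> U" "u \<notin> T"
    using not_subset_if_dim_less[OF assms] by blast
  from weight_span_insert[OF assms(1) this]
  have "weight \<phi> scale U T + 1 \<le> F.dim (U \<inter> span (insert u T))"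
    by (simp add: weight_def)
  also have "\<dots> \<le> F.dim U"
    by (rule F.dim_subset) simp
  finally show ?thesis by simp
qed

text \<open>Induction on the codimension of \<open>T\<close>: each adjoined vector of
  \<open>U\<close> lowers it by one, until it is 1.\<close>

lemma hyperplane_of_larger_defect:
  assumes "subspace T" and "dim T < dim UNIV"
  shows "\<exists>H. is_hyperplane scale H \<and> defect \<phi> scale U T \<le> defect \<phi> scale U H"
  using assms
proof (induction "dim UNIV - dim T" arbitrary: T rule: less_induct)
  case less
  show ?case
  proof (cases "dim T + 1 = dim UNIV")
    case True
    then show ?thesis using less.prems by (auto simp: is_hyperplane_def)
  next
    case False
    obtain u where u: "u \<in> U" "u \<notin> T"
      using not_subset_if_dim_less[OF less.prems] by blast
    let ?T = "span (insert u T)"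
    note dim = dim_span_insert[OF less.prems(1) u(2)]
    \<comment> \<open>As \<open>T\<close> is not yet a hyperplane, the enlarged space is still
      proper.\<close>
    have "\<exists>H. is_hyperplane scale H \<and> defect \<phi> scale U ?T \<le> defect \<phi> scale U H"
      by (rule less.hyps) (use False less.prems dim in auto)
    moreover have "defect \<phi> scale U T \<le> defect \<phi> scale U ?T"
      using weight_span_insert[OF less.prems(1) u] dim by (simp add: defect_def)
    ultimately show ?thesis by force
  qed
qed

text \<open>Ensures that \<open>Min\<close> over such a set, once it is nonempty, is a true
  minimum.\<close>

lemma finite_dims: "finite {dim T | T. P T}"
proof -
  have "finite (UNIV :: 'v set set)"
    using finite_UNIV by (simp add: Finite_Set.finite_set)
  then have "finite (dim ` {T. P T})"
    by (intro finite_imageI) (rule finite_subset[OF subset_UNIV])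
  then show ?thesis by (simp only: setcompr_eq_image)
qed

end

theorem theorem1p10:
  fixes \<phi> :: "'f::{field,finite} \<Rightarrow> 'e::{field,finite}"
    and scale :: "'e \<Rightarrow> 'v::ab_group_add \<Rightarrow> 'v"
    and U :: "'v set"
    and q k m n t\<^sub>s :: nat
  assumes "primepow q" and "k > 0" and "m > 0"
    and "CARD('f) = q" and "CARD('e) = q ^ m"
    and "field_embedding \<phi>"
    and "vector_space scale" and "vector_space.dim scale (UNIV :: 'v set) = k"
    and "module.subspace (restrict_scalars \<phi> scale) U"
    and "vector_space.dim (restrict_scalars \<phi> scale) U = n"
    and "module.span scale U = UNIV"
    and "t\<^sub>s = Min {vector_space.dim scale T | T.
                   module.subspace scale T \<and> defect \<phi> scale U T = int n - int k}"
  shows "t\<^sub>s < k \<longleftrightarrow>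
    (\<exists>H. is_hyperplane scale H \<and> int (weight \<phi> scale U H) = int n - 1)"
proof -
  have "finite (UNIV :: 'v set)"
    using finite_UNIV_if_dim_pos[of scale] assms by simp
  with assms interpret finite_restriction \<phi> scale U
    by (simp add: finite_restriction_def finite_restriction_axioms_def)
  let ?D = "{dim T | T. subspace T \<and> defect \<phi> scale U T = int n - int k}"
  have fin: "finite ?D" by (rule finite_dims)
  \<comment> \<open>The whole space has defect \<open>n - k\<close>, so the minimum is
    attained.\<close>
  have "k \<in> ?D"
    using assms(8,10) subspace_UNIV by (auto simp: defect_UNIV intro!: exI[of _ UNIV])
  show ?thesis
  proof
    assume "t\<^sub>s < k"
    moreover have "t\<^sub>s \<in> ?D"
      using Min_in[OF fin] \<open>k \<in> ?D\<close> assms(12) by blast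
    ultimately obtain T where T: "subspace T" "dim T < dim UNIV"
        "defect \<phi> scale U T = int n - int k"
      using assms(8) by auto
    obtain H where H: "is_hyperplane scale H" "defect \<phi> scale U T \<le> defect \<phi> scale U H"
      using hyperplane_of_larger_defect[OF T(1,2)] by blast
    have "weight \<phi> scale U H < n"
      using weight_less_if_dim_less[of H] H(1) assms(10) by (simp add: is_hyperplane_def)
    \<comment> \<open>Since \<open>H\<close> has dimension \<open>k - 1\<close>, a defect of at
      least \<open>n - k\<close> means weight at least \<open>n - 1\<close>.\<close>
    with H T(3) assms(8) have "int (weight \<phi> scale U H) = int n - 1"
      by (simp add: is_hyperplane_def defect_def)
    with H(1) show "\<exists>H. is_hyperplane scale H \<and> int (weight \<phi> scale U H) = int n - 1"
      by blast
  next
    assume "\<exists>H. is_hyperplane scale H \<and> int (weight \<phi> scale U H) = int n - 1"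
    then obtain H where H: "is_hyperplane scale H" "int (weight \<phi> scale U H) = int n - 1"
      by blast
    \<comment> \<open>The defect of \<open>H\<close> is
      \<open>(n - 1) - (k - 1) = n - k\<close>.\<close>
    then have "dim H \<in> ?D"
      using assms(8) by (auto simp: is_hyperplane_def defect_def)
    then have "t\<^sub>s \<le> dim H"
      using Min_le[OF fin] assms(12) by blast
    then show "t\<^sub>s < k"
      using H(1) assms(8) by (simp add: is_hyperplane_def)
  qed
qed

end
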